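(* Let $k$ and $t$ be positive integers with $t\leq k$, and let $\mathbb{F}(k,t)$ be the family of $k$-sets defined in the context below. Then the transversal size of $\mathbb{F}(k,t)$ equals $t$; that is, the minimum cardinality of a set $C$ that intersects every block of $\mathbb{F}(k,t)$ is exactly $t$.
   Context: A family is a collection of finite sets, whose members are called blocks. A blocking set of a nonempty finite family $\mathcal{G}$ is a set $C$ that intersects every block of $\mathcal{G}$; the transversal size of $\mathcal{G}$ is the minimum size of a blocking set of $\mathcal{G}$. Construction of $\mathbb{F}(k,t)$: Let $k,t$ be positive integers with $t\leq k$. Let $X_0,\dots,X_{t-1}$ be $t$ pairwise disjoint sets with $|X_n|=k-\lfloor t/2\rfloor$ if $0\leq n\leq \lfloor (t-1)/2\rfloor$ and $|X_n|=k-\lfloor (t-1)/2\rfloor$ if $\lfloor (t-1)/2\rfloor+1\leq n\leq t-1$. Write $X_n=\{x^n_p : 0\leq p\leq |X_n|-1\}$. Then $\mathbb{F}(k,t)$ is the family of all $k$-sets of the form $$X_n\sqcup\{x^{n+i}_{p_i} : 1\leq i\leq k-|X_n|\},$$ where $0\leq n\leq t-1$, the superscript $n+i$ is taken modulo $t$, and $(p_m)_{m\geq 0}$ ranges over all finite sequences of nonnegative integers satisfying $p_0=0$ and, for each $m\geq 1$, $p_m=p_{m-1}$ or $p_m=1+p_{m-1}$. *)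

theory Defs
  imports Main "HOL-Library.Disjoint_Sets"
begin

definition blocking_set :: "'a set set \<Rightarrow> 'a set \<Rightarrow> bool" where
  "blocking_set G C \<longleftrightarrow> (\<forall>B\<in>G. C \<inter> B \<noteq> {})"

(* Finiteness of C is required because card returns 0 on infinite sets. *)
definition transversal_size :: "'a set set \<Rightarrow> nat" where
  "transversal_size G = (LEAST s. \<exists>C. finite C \<and> blocking_set G C \<and> card C = s)"

(* The minimum is attained whenever G is finite and has no empty block. *)
lemma transversal_size_attained:
  assumes "finite G" "{} \<notin> G"
  shows "\<exists>C. finite C \<and> blocking_set G C \<and> card C = transversal_size G"
proof -
  define C where "C = (\<lambda>B. SOME b. b \<in> B) ` G"
  have "(SOME b. b \<in> B) \<in> B" if "B \<in> G" for B
    using that assms(2) by (metis some_in_eq)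
  then have "blocking_set G C" unfolding blocking_set_def C_def by blast
  moreover have "finite C" using assms(1) by (simp add: C_def)
  ultimately have "\<exists>s C. finite C \<and> blocking_set G C \<and> card C = s" by blast
  then show ?thesis unfolding transversal_size_def by (rule LeastI_ex)
qed

definition part_size :: "nat \<Rightarrow> nat \<Rightarrow> nat \<Rightarrow> nat" where
  "part_size k t n = (if n \<le> (t - 1) div 2 then k - t div 2 else k - (t - 1) div 2)"

(* The t pairwise disjoint sets X 0, ..., X (t - 1) of the construction, with
   X n = {x n p | p. p < card (X n)} enumerated without repetition. *)
definition ground_parts ::
    "nat \<Rightarrow> nat \<Rightarrow> (nat \<Rightarrow> 'a set) \<Rightarrow> (nat \<Rightarrow> nat \<Rightarrow> 'a) \<Rightarrow> bool" where
  "ground_parts k t X x \<longleftrightarrow>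
     disjoint_family_on X {..<t} \<and>
     (\<forall>n<t. finite (X n) \<and> card (X n) = part_size k t n \<and>
            bij_betw (x n) {..<card (X n)} (X n))"

(* Only the values p 0, ..., p l matter for an index range 1, ..., l, so p stands for
   a finite sequence and is constrained only there. *)
definition step_seq :: "nat \<Rightarrow> (nat \<Rightarrow> nat) \<Rightarrow> bool" where
  "step_seq l p \<longleftrightarrow> p 0 = 0 \<and> (\<forall>m\<in>{1..l}. p m = p (m - 1) \<or> p m = 1 + p (m - 1))"

(* That the blocks really are k-sets, with every x n p in range, is
   \<open>family_F_block\<close> below. *)
definition family_F ::
    "nat \<Rightarrow> nat \<Rightarrow> (nat \<Rightarrow> 'a set) \<Rightarrow> (nat \<Rightarrow> nat \<Rightarrow> 'a) \<Rightarrow> 'a set set" where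
  "family_F k t X x =
     {X n \<union> {x ((n + i) mod t) (p i) | i. 1 \<le> i \<and> i \<le> k - card (X n)} | n p.
        n < t \<and> step_seq (k - card (X n)) p}"

lemma ground_parts_exist:
  "ground_parts k t (\<lambda>n. {n} \<times> {..<part_size k t n}) Pair"
  by (auto simp: ground_parts_def disjoint_family_on_def bij_betw_def inj_on_def
      card_cartesian_product)

lemma step_seq_le:
  assumes "step_seq l p" "i \<le> l"
  shows "p i \<le> i"
  using assms(2)
proof (induction i)
  case 0
  then show ?case using assms(1) by (simp add: step_seq_def)
next
  case (Suc i)
  then have "p (Suc i) = p i \<or> p (Suc i) = 1 + p i"
    using assms(1) unfolding step_seq_def by (metis One_nat_def Suc_leI atLeastAtMost_iff diff_Suc_1 zero_less_Suc)
  with Suc show ?case by auto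
qed

lemma part_size_range:
  assumes "0 < t" "t \<le> k" "n < t" "1 \<le> i" "i \<le> k - part_size k t n"
  shows "i < part_size k t ((n + i) mod t)" "i < t"
proof -
  have r: "i \<le> (if n \<le> (t - 1) div 2 then t div 2 else (t - 1) div 2)"
    using assms by (auto simp: part_size_def split: if_splits)
  then show "i < t" using assms by (auto split: if_splits)
  then have "(n + i) mod t = (if n + i < t then n + i else n + i - t)"
    using assms by (auto simp: le_mod_geq)
  moreover define a b where "a = (t - 1) div 2" and "b = t div 2"
  moreover have "a + b + 1 = t" "a \<le> b" "b \<le> a + 1"
    using assms(1) unfolding a_def b_def by presburger+
  ultimately show "i < part_size k t ((n + i) mod t)"
    using r assms unfolding part_size_def a_def [symmetric] b_def [symmetric]
    by (simp split: if_splits; linarith)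
qed

lemma family_F_block:
  assumes "0 < t" "t \<le> k" "ground_parts k t X x" "B \<in> family_F k t X x"
  shows "B \<subseteq> (\<Union>n<t. X n)" "finite B" "card B = k"
proof -
  from assms(4) obtain n p where n: "n < t" and p: "step_seq (k - card (X n)) p"
    and B: "B = X n \<union> {x ((n + i) mod t) (p i) | i. 1 \<le> i \<and> i \<le> k - card (X n)}"
    unfolding family_F_def by blast
  let ?l = "k - card (X n)"
  let ?f = "\<lambda>i. x ((n + i) mod t) (p i)"
  have B': "B = X n \<union> ?f ` {1..?l}" unfolding B by auto
  have cX: "finite (X m)" "card (X m) = part_size k t m" "bij_betw (x m) {..<card (X m)} (X m)"
    if "m < t" for m using assms(3) that by (auto simp: ground_parts_def)
  have disj: "X a \<inter> X b = {}" if "a < t" "b < t" "a \<noteq> b" for a b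
    using assms(3) that by (auto simp: ground_parts_def disjoint_family_on_def)
  have it: "i < t" if "i \<in> {1..?l}" for i
    using part_size_range(2)[OF assms(1,2) n] that cX(2)[OF n] by auto
  have fX: "?f i \<in> X ((n + i) mod t)" if i: "i \<in> {1..?l}" for i
  proof -
    have m: "(n + i) mod t < t" using assms(1) by simp
    have "p i \<le> i" using step_seq_le[OF p] i by simp
    also have "i < card (X ((n + i) mod t))"
      using part_size_range(1)[OF assms(1,2) n] i cX(2)[OF n] cX(2)[OF m] by auto
    finally show ?thesis using cX(3)[OF m] by (auto simp: bij_betw_def)
  qed
  have md: "(n + i) mod t = (if n + i < t then n + i else n + i - t)" if "i < t" for i
    using n that by (auto simp: le_mod_geq)
  have nn: "(n + i) mod t \<noteq> n" if "i \<in> {1..?l}" for i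
    using md[OF it[OF that]] it[OF that] that n by (auto split: if_splits)
  have inj: "inj_on ?f {1..?l}"
  proof (rule inj_onI)
    fix i j assume ij: "i \<in> {1..?l}" "j \<in> {1..?l}" "?f i = ?f j"
    then have "(n + i) mod t = (n + j) mod t"
      using disj[of "(n + i) mod t" "(n + j) mod t"] fX[of i] fX[of j] assms(1) by force
    then show "i = j"
      using md[OF it[OF ij(1)]] md[OF it[OF ij(2)]] it[OF ij(1)] it[OF ij(2)] n
      by (auto split: if_splits)
  qed
  have dj: "X n \<inter> ?f ` {1..?l} = {}"
  proof -
    have "?f i \<notin> X n" if "i \<in> {1..?l}" for i
      using disj[of "(n + i) mod t" n] fX[OF that] nn[OF that] n assms(1) by auto
    then show ?thesis by auto
  qed
  show "finite B" unfolding B' using cX(1)[OF n] by simp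
  have "card B = card (X n) + ?l"
    unfolding B' using card_Un_disjoint[OF cX(1)[OF n] _ dj] card_image[OF inj] by simp
  then show "card B = k" using cX(2)[OF n] by (auto simp: part_size_def split: if_splits)
  show "B \<subseteq> (\<Union>n<t. X n)"
  proof
    fix b assume "b \<in> B"
    then consider "b \<in> X n" | i where "i \<in> {1..?l}" "b = ?f i" unfolding B' by auto
    then show "b \<in> (\<Union>n<t. X n)"
    proof cases
      case 1 then show ?thesis using n by auto
    next
      case 2 then show ?thesis using fX[of i] assms(1) by (metis UN_I lessThan_iff mod_less_divisor)
    qed
  qed
qed

lemma family_F_finite_nonempty:
  assumes "0 < t" "t \<le> k" "ground_parts k t X x"
  shows "finite (family_F k t X x)" "family_F k t X x \<noteq> {}"
proof -
  have "family_F k t X x \<subseteq> Pow (\<Union>n<t. X n)" using family_F_block(1)[OF assms] by auto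
  moreover have "finite (\<Union>n<t. X n)" using assms(3) by (auto simp: ground_parts_def)
  ultimately show "finite (family_F k t X x)" by (meson finite_Pow_iff finite_subset)
  have "step_seq (k - card (X 0)) (\<lambda>_. 0)" by (simp add: step_seq_def)
  then show "family_F k t X x \<noteq> {}" using assms(1) unfolding family_F_def by blast
qed

end

theory Submission
  imports Defs
begin

text \<open>
  One point from each part gives a blocking set of size \<open>t\<close>. Conversely, if \<open>C\<close> has fewer
  than \<open>t\<close> points, the numbers \<open>c m - 1\<close> with \<open>c m = card (C \<inter> X m)\<close> have negative sum around
  the cycle, so by the cycle lemma there is a starting index \<open>n\<close> from which all partial sums are
  negative. In particular \<open>c n = 0\<close>. The set of positions reachable in \<open>i\<close> steps without
  meeting \<open>C\<close> grows by at least one per step before the points of \<open>C\<close> are removed; since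
  \<open>c (n + 1) + \<dots> + c (n + i) \<le> i\<close> for all \<open>i\<close>, it never becomes empty, which yields a block
  disjoint from \<open>C\<close>.
\<close>

text \<open>Start at the last maximum of the prefix sums over one period: later prefix sums in that
  period are strictly smaller, and past its end the negative total is added.\<close>

lemma cycle_lemma:
  fixes a :: "nat \<Rightarrow> int"
  assumes "0 < t" and neg: "(\<Sum>j<t. a j) < 0"
  obtains n where "n < t" "\<And>i. i < t \<Longrightarrow> (\<Sum>j\<le>i. a ((n + j) mod t)) < 0"
proof -
  define S where "S m = (\<Sum>j<m. a (j mod t))" for m
  have S_t: "S t < 0"
    using neg unfolding S_def by simp
  have S_add: "S (n + m) = S n + (\<Sum>j<m. a ((n + j) mod t))" for n m
    unfolding S_def by (induction m) auto
  have S_shift: "S (t + m) = S t + S m" for m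
    unfolding S_add[of t m] by (simp add: S_def)
  \<comment> \<open>The last index in \<open>{..<t}\<close> at which \<open>S\<close> is maximal: the summand \<open>m\<close> breaks ties.\<close>
  define f where "f m = int t * S m + int m" for m
  obtain n where n: "n < t" and max: "\<And>m. m < t \<Longrightarrow> f m \<le> f n"
  proof -
    have "Max (f ` {..<t}) \<in> f ` {..<t}"
      using \<open>0 < t\<close> by (intro Max_in) auto
    then obtain n where "n < t" "f n = Max (f ` {..<t})"
      by auto
    then show thesis
      using that[of n] by simp
  qed
  have le: "S m \<le> S n" if "m < t" for m
  proof (rule ccontr)
    assume "\<not> S m \<le> S n"
    \<comment> \<open>As \<open>S\<close> is integral, a larger value adds at least \<open>t\<close>
      to \<open>f\<close>, more than the tie-breaker \<open>n < t\<close> can offset.\<close>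
    then have "int t * (S n + 1) \<le> int t * S m"
      by (intro mult_left_mono) auto
    then show False
      using max[OF that] n by (simp add: f_def distrib_left)
  qed
  have less: "S m < S n" if "m < t" "n < m" for m
    using max[OF that(1)] le[OF that(1)] that(2) by (cases "S m = S n") (auto simp: f_def)
  have "(\<Sum>j\<le>i. a ((n + j) mod t)) < 0" if "i < t" for i
  proof -
    have "S (n + Suc i) < S n"
    proof (cases "n + Suc i < t")
      case True
      then show ?thesis by (intro less) auto
    next
      case False
      then obtain m where m: "n + Suc i = t + m"
        by (metis le_Suc_ex not_less)
      then have "m < t"
        using n that by linarith
      then show ?thesis
        unfolding m S_shift using le[of m] S_t by simp
    qed
    then show ?thesis
      unfolding S_add by (simp add: lessThan_Suc_atMost)
  qed
  with n show thesis
    using that by blast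
qed

text \<open>Only end positions are kept, since the next step depends on the last value alone. Index
  0 is not tested because it contributes no point to a block.\<close>

definition avoiding_ends :: "(nat \<Rightarrow> nat set) \<Rightarrow> nat \<Rightarrow> nat set" where
  "avoiding_ends D l = {p l | p. step_seq l p \<and> (\<forall>i\<in>{1..l}. p i \<notin> D i)}"

lemma finite_avoiding_ends: "finite (avoiding_ends D l)"
  by (rule finite_subset[of _ "{..l}"]) (auto simp: avoiding_ends_def step_seq_le)

lemma avoiding_ends_Suc:
  assumes "q \<in> avoiding_ends D l" "r = q \<or> r = Suc q" "r \<notin> D (Suc l)"
  shows "r \<in> avoiding_ends D (Suc l)"
proof -
  obtain p where p: "q = p l" "step_seq l p" "\<forall>i\<in>{1..l}. p i \<notin> D i"
    using assms(1) by (auto simp: avoiding_ends_def)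
  have "step_seq (Suc l) (p(Suc l := r))"
    using p assms(2) by (auto simp: step_seq_def)
  moreover have "\<forall>i\<in>{1..Suc l}. (p(Suc l := r)) i \<notin> D i"
    using p(3) assms(3) by auto
  ultimately show ?thesis
    unfolding avoiding_ends_def by (intro CollectI exI[of _ "p(Suc l := r)"]) simp
qed

text \<open>Induction on \<open>l\<close>: each step gains a position and loses at most
  \<open>card (D (Suc l))\<close>. The additive form avoids truncated subtraction.\<close>

lemma card_avoiding_ends:
  assumes fin: "\<And>i. finite (D i)"
    and "\<And>i. 1 \<le> i \<Longrightarrow> i \<le> l \<Longrightarrow> (\<Sum>j=1..i. card (D j)) \<le> i"
  shows "l < card (avoiding_ends D l) + (\<Sum>j=1..l. card (D j))"
  using assms(2)
proof (induction l)
  case 0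
  have "step_seq 0 (\<lambda>_. 0)"
    by (simp add: step_seq_def)
  then have "avoiding_ends D 0 \<noteq> {}"
    by (auto simp: avoiding_ends_def)
  then show ?case
    using finite_avoiding_ends[of D 0] by (simp add: card_gt_0_iff)
next
  case (Suc l)
  let ?R = "avoiding_ends D l"
  have IH: "l < card ?R + (\<Sum>j=1..l. card (D j))"
    using Suc by simp
  have "(\<Sum>j=1..l. card (D j)) \<le> l"
    using Suc.prems[of l] by (cases l) auto
  then have "?R \<noteq> {}"
    using IH by auto
  \<comment> \<open>Staying keeps all of \<open>?R\<close> as candidates; stepping up from the
    maximum supplies a new one.\<close>
  then have Max: "Max ?R \<in> ?R" and "Suc (Max ?R) \<notin> ?R"
    using Max_ge[OF finite_avoiding_ends, of "Suc (Max ?R)" D l]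
    by (auto intro: Max_in finite_avoiding_ends)
  then have "Suc (card ?R) = card (insert (Suc (Max ?R)) ?R)"
    by (simp add: finite_avoiding_ends)
  also have "\<dots> \<le> card (avoiding_ends D (Suc l) \<union> D (Suc l))"
    using Max avoiding_ends_Suc[of _ D l]
    by (intro card_mono) (auto simp: finite_avoiding_ends fin)
  also have "\<dots> \<le> card (avoiding_ends D (Suc l)) + card (D (Suc l))"
    by (rule card_Un_le)
  finally show ?case
    using IH by simp
qed

lemma step_seq_avoiding:
  assumes "\<And>i. finite (D i)"
    and le: "\<And>i. 1 \<le> i \<Longrightarrow> i \<le> l \<Longrightarrow> (\<Sum>j=1..i. card (D j)) \<le> i"
  obtains p where "step_seq l p" "\<And>i. 1 \<le> i \<Longrightarrow> i \<le> l \<Longrightarrow> p i \<notin> D i"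
proof -
  have "(\<Sum>j=1..l. card (D j)) \<le> l"
    using le[of l] by (cases l) auto
  then have "card (avoiding_ends D l) \<noteq> 0"
    using card_avoiding_ends[of D l, OF assms] by simp
  then have "avoiding_ends D l \<noteq> {}"
    by auto
  then show thesis
    using that by (auto simp: avoiding_ends_def)
qed

lemma blocking_set_family_F_transversal:
  assumes "0 < t" "t \<le> k" and gp: "ground_parts k t X x"
  shows "blocking_set (family_F k t X x) ((\<lambda>n. x n 0) ` {..<t})"
    and "card ((\<lambda>n. x n 0) ` {..<t}) = t"
proof -
  have mem: "x n 0 \<in> X n" if "n < t" for n
  proof -
    have "0 < part_size k t n"
      using assms(1,2) by (auto simp: part_size_def)
    then show ?thesis
      using gp that unfolding ground_parts_def by (metis bij_betwE lessThan_iff)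
  qed
  then show "blocking_set (family_F k t X x) ((\<lambda>n. x n 0) ` {..<t})"
    unfolding blocking_set_def family_F_def by blast
  have "inj_on (\<lambda>n. x n 0) {..<t}"
    using gp mem unfolding ground_parts_def disjoint_family_on_def inj_on_def
    by (metis disjoint_iff lessThan_iff)
  then show "card ((\<lambda>n. x n 0) ` {..<t}) = t"
    by (simp add: card_image)
qed

lemma blocking_set_family_F_card_ge:
  assumes "0 < t" "t \<le> k" and gp: "ground_parts k t X x"
    and "finite C" and block: "blocking_set (family_F k t X x) C"
  shows "t \<le> card C"
proof (rule ccontr)
  assume "\<not> t \<le> card C"
  define c where "c m = card (C \<inter> X m)" for m
  have X: "card (X m) = part_size k t m" "bij_betw (x m) {..<card (X m)} (X m)"
    if "m < t" for m using gp that by (auto simp: ground_parts_def)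
  have "(\<Sum>m<t. c m) = card (\<Union>m<t. C \<inter> X m)"
    unfolding c_def using gp \<open>finite C\<close>
    by (subst card_UN_disjoint) (auto simp: ground_parts_def disjoint_family_on_def)
  \<comment> \<open>Only an inequality, as \<open>C\<close> may have points outside all
    parts.\<close>
  also have "\<dots> \<le> card C"
    using \<open>finite C\<close> by (intro card_mono) auto
  finally have "(\<Sum>m<t. int (c m) - 1) < 0"
    using \<open>\<not> t \<le> card C\<close> by (simp add: sum_subtractf flip: of_nat_sum)
  then obtain n where n: "n < t"
    and sum_n: "\<And>i. i < t \<Longrightarrow> (\<Sum>j\<le>i. int (c ((n + j) mod t)) - 1) < 0"
    using cycle_lemma[OF \<open>0 < t\<close>] by blast
  have "C \<inter> X n = {}"
    using sum_n[of 0] n \<open>finite C\<close> by (simp add: c_def)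
  let ?l = "k - card (X n)"
  have range: "i < card (X ((n + i) mod t))" "i < t" if "1 \<le> i" "i \<le> ?l" for i
    using part_size_range[OF assms(1,2) n that(1)] that(2) X(1)[OF n]
      X(1)[of "(n + i) mod t"] \<open>0 < t\<close> by auto
  \<comment> \<open>The forbidden values of \<open>p i\<close>. The bound on \<open>q\<close> keeps
    to the range where \<open>x m\<close> enumerates \<open>X m\<close>, so that \<open>D i\<close>
    has as many elements as \<open>C\<close> has points in that part.\<close>
  define D where "D i = (let m = (n + i) mod t in {q \<in> {..<card (X m)}. x m q \<in> C})" for i
  have card_D: "card (D i) = c ((n + i) mod t)" for i
  proof -
    let ?m = "(n + i) mod t"
    have bij: "bij_betw (x ?m) {..<card (X ?m)} (X ?m)"
      using X(2) \<open>0 < t\<close> by simp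
    then have "bij_betw (x ?m) (D i) (C \<inter> X ?m)"
      unfolding D_def Let_def by (rule bij_betw_subset) (use bij in \<open>auto simp: bij_betw_def\<close>)
    then show ?thesis
      unfolding c_def by (rule bij_betw_same_card)
  qed
  have "(\<Sum>j=1..i. card (D j)) \<le> i" if "1 \<le> i" "i \<le> ?l" for i
  proof -
    have "(\<Sum>j\<le>i. int (card (D j))) < int i + 1"
      using sum_n[OF range(2)[OF that]] by (simp add: card_D sum_subtractf)
    then have "(\<Sum>j\<le>i. card (D j)) < i + 1"
      by (simp flip: of_nat_sum)
    moreover have "(\<Sum>j=1..i. card (D j)) \<le> (\<Sum>j\<le>i. card (D j))"
      by (rule sum_mono2) auto
    ultimately show ?thesis by simp
  qed
  moreover have "finite (D i)" for i
    by (simp add: D_def Let_def)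
  ultimately obtain p where p: "step_seq ?l p" "\<And>i. 1 \<le> i \<Longrightarrow> i \<le> ?l \<Longrightarrow> p i \<notin> D i"
    using step_seq_avoiding[of D ?l] by blast
  \<comment> \<open>Since \<open>p i \<le> i\<close> is below the size of the part, avoiding
    \<open>D i\<close> really means avoiding \<open>C\<close>.\<close>
  have "x ((n + i) mod t) (p i) \<notin> C" if "1 \<le> i" "i \<le> ?l" for i
    using p(2)[OF that] step_seq_le[OF p(1) that(2)] range(1)[OF that]
    by (simp add: D_def Let_def)
  then have "C \<inter> (X n \<union> {x ((n + i) mod t) (p i) | i. 1 \<le> i \<and> i \<le> ?l}) = {}"
    using \<open>C \<inter> X n = {}\<close> by blast
  moreover have "X n \<union> {x ((n + i) mod t) (p i) | i. 1 \<le> i \<and> i \<le> ?l} \<in> family_F k t X x"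
    unfolding family_F_def using n p(1) by blast
  ultimately show False
    using block unfolding blocking_set_def by blast
qed

theorem theorem1p2:
  fixes k t :: nat and X :: "nat \<Rightarrow> 'a set" and x :: "nat \<Rightarrow> nat \<Rightarrow> 'a"
  assumes "0 < t" "t \<le> k" and "ground_parts k t X x"
  shows "transversal_size (family_F k t X x) = t"
  unfolding transversal_size_def
proof (rule Least_equality)
  show "\<exists>C. finite C \<and> blocking_set (family_F k t X x) C \<and> card C = t"
    using blocking_set_family_F_transversal[OF assms] by blast
next
  fix s assume "\<exists>C. finite C \<and> blocking_set (family_F k t X x) C \<and> card C = s"
  then show "t \<le> s"
    using blocking_set_family_F_card_ge[OF assms] by blast
qed

end
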